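(* In the $L^1$ norm on $\mathbb{R}^2$, for every positive integer $n\leq 8$ there exists a strong crescent configuration of size $n$.
   Context: Let $\|\cdot\|$ be the $L^1$ (taxicab) norm on $\mathbb{R}^2$, $\|(x,y)\|=|x|+|y|$. A $\|\cdot\|$ circle is a set $\{q\in\mathbb{R}^2:\|q-p\|=r\}$ with $p\in\mathbb{R}^2$, $r>0$. A set $S\subset\mathbb{R}^2$ of $n$ points is a line-like configuration of size $n$ in $\|\cdot\|$ if its distance graph is isomorphic to that of $n$ equally spaced points on a line, i.e. there is a bijection $\phi: S\to\{1,\dots,n\}$ such that for all $a,b,c,d\in S$: $\|a-b\|=\|c-d\|$ if and only if $|\phi(a)-\phi(b)|=|\phi(c)-\phi(d)|$. A set of points lies in strong general position in $\|\cdot\|$ if (1) no three of its points lie on a common line, (2) no four of its points lie on a common $\|\cdot\|$ circle, and (3) no four of its points form a line-like configuration of size four in $\|\cdot\|$. A set of $n$ points in $\mathbb{R}^2$ is a strong crescent configuration of size $n$ in $\|\cdot\|$ if (1) it lies in strong general position in $\|\cdot\|$, (2) it determines exactly $n-1$ distinct (nonzero) distances, measured in $\|\cdot\|$, and (3) for each $1\leq i\leq n-1$ there is a distance which occurs with multiplicity exactly $i$ among the unordered pairs of distinct points. *)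

theory Defs
  imports "HOL-Analysis.Analysis"
begin

(* The library norm on real \<times> real is the Euclidean one, so the taxicab norm gets its own constant. *)
definition l1_norm :: "real \<times> real \<Rightarrow> real" where
  "l1_norm p = \<bar>fst p\<bar> + \<bar>snd p\<bar>"

definition l1_circle :: "real \<times> real \<Rightarrow> real \<Rightarrow> (real \<times> real) set" where
  "l1_circle p r = {q. l1_norm (q - p) = r}"

(* Labels are cast to int because subtraction on nat truncates;
   the bijection onto {1..n} forces S to be finite with n elements. *)
definition l1_line_like :: "nat \<Rightarrow> (real \<times> real) set \<Rightarrow> bool" where
  "l1_line_like n S \<longleftrightarrow>
     (\<exists>\<phi> :: real \<times> real \<Rightarrow> nat. bij_betw \<phi> S {1..n} \<and>
        (\<forall>a\<in>S. \<forall>b\<in>S. \<forall>c\<in>S. \<forall>d\<in>S.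
           l1_norm (a - b) = l1_norm (c - d) \<longleftrightarrow>
           \<bar>int (\<phi> a) - int (\<phi> b)\<bar> = \<bar>int (\<phi> c) - int (\<phi> d)\<bar>))"

definition l1_strong_general_position :: "(real \<times> real) set \<Rightarrow> bool" where
  "l1_strong_general_position S \<longleftrightarrow>
     (\<forall>T\<subseteq>S. card T = 3 \<longrightarrow> \<not> collinear T) \<and>
     (\<forall>T\<subseteq>S. card T = 4 \<longrightarrow> \<not> (\<exists>p r. r > 0 \<and> T \<subseteq> l1_circle p r)) \<and>
     (\<forall>T\<subseteq>S. card T = 4 \<longrightarrow> \<not> l1_line_like 4 T)"

definition l1_distances :: "(real \<times> real) set \<Rightarrow> real set" where
  "l1_distances S = {l1_norm (a - b) | a b. a \<in> S \<and> b \<in> S \<and> a \<noteq> b}"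

(* Unordered pairs are represented as two-element sets {a, b}. *)
definition l1_multiplicity :: "(real \<times> real) set \<Rightarrow> real \<Rightarrow> nat" where
  "l1_multiplicity S \<delta> =
     card {{a, b} | a b. a \<in> S \<and> b \<in> S \<and> a \<noteq> b \<and> l1_norm (a - b) = \<delta>}"

definition l1_strong_crescent :: "nat \<Rightarrow> (real \<times> real) set \<Rightarrow> bool" where
  "l1_strong_crescent n S \<longleftrightarrow>
     finite S \<and> card S = n \<and>
     l1_strong_general_position S \<and>
     card (l1_distances S) = n - 1 \<and>
     (\<forall>i\<in>{1..n - 1}. \<exists>\<delta>\<in>l1_distances S. l1_multiplicity S \<delta> = i)"

end

theory Submission
  imports Defs
begin

text \<open>
  In the coordinates \<open>u = x + y\<close>, \<open>v = x - y\<close> the taxicab norm becomes the maximum norm and circles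
  become boundaries of axis-parallel squares. Finitely many points on such a boundary either are
  covered by one horizontal and one vertical line, or meet two opposite sides. In the second case
  the side length is a coordinate difference, and after sliding the square along these two sides
  its position is a coordinate, too. For points with integer \<open>(u, v)\<close> coordinates, all
  conditions on a crescent configuration thereby become finitely many integer comparisons, which
  are evaluated on explicit configurations found by computer search.
\<close>

section \<open>Rotated integer coordinates\<close>

text \<open>The inverse of the map \<open>(x, y)\<close> to \<open>(x + y, x - y)\<close>. Halving
  is done over the reals, so every pair of integers is admissible, without a parity
  condition.\<close>

definition of_uv :: "int \<times> int \<Rightarrow> real \<times> real" where
  "of_uv p = ((of_int (fst p) + of_int (snd p)) / 2, (of_int (fst p) - of_int (snd p)) / 2)"

definition chebyshev :: "int \<times> int \<Rightarrow> int \<times> int \<Rightarrow> int" where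
  "chebyshev p q = max \<bar>fst p - fst q\<bar> \<bar>snd p - snd q\<bar>"

lemma abs_add_abs_eq_max:
  fixes x y :: real
  shows "\<bar>x\<bar> + \<bar>y\<bar> = max \<bar>x + y\<bar> \<bar>x - y\<bar>"
  by (simp add: max_def abs_if)

lemma inj_of_uv: "inj of_uv"
proof (rule injI)
  fix p q
  assume "of_uv p = of_uv q"
  then have "real_of_int (fst p) + of_int (snd p) = of_int (fst q) + of_int (snd q)"
    "real_of_int (fst p) - of_int (snd p) = of_int (fst q) - of_int (snd q)"
    by (simp_all add: of_uv_def)
  then show "p = q"
    by (simp add: prod_eq_iff)
qed

lemma l1_norm_of_uv_diff: "l1_norm (of_uv p - of_uv q) = of_int (chebyshev p q)"
proof -
  have "fst (of_uv p - of_uv q) + snd (of_uv p - of_uv q) = of_int (fst p - fst q)"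
    "fst (of_uv p - of_uv q) - snd (of_uv p - of_uv q) = of_int (snd p - snd q)"
    by (simp_all add: of_uv_def field_simps)
  then show ?thesis
    unfolding l1_norm_def abs_add_abs_eq_max chebyshev_def by simp
qed

text \<open>The centre of a circle is an arbitrary real point, so only the point on the circle is
  taken to be integral. In rotated coordinates the centre is \<open>(a + b, a - b)\<close> and
  \<open>r\<close> is half the side of the square.\<close>

lemma of_uv_in_l1_circle:
  assumes "of_uv x \<in> l1_circle (a, b) r"
  shows "max \<bar>of_int (fst x) - (a + b)\<bar> \<bar>of_int (snd x) - (a - b)\<bar> = r"
proof -
  have "fst (of_uv x - (a, b)) + snd (of_uv x - (a, b)) = of_int (fst x) - (a + b)"
    "fst (of_uv x - (a, b)) - snd (of_uv x - (a, b)) = of_int (snd x) - (a - b)"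
    by (simp_all add: of_uv_def field_simps)
  then show ?thesis
    using assms unfolding l1_circle_def l1_norm_def abs_add_abs_eq_max by simp
qed

text \<open>The rotation is linear, so both differences from \<open>p\<close> remain multiples of
  one direction vector, and their determinant vanishes.\<close>

lemma collinear_of_uvD:
  assumes "collinear {of_uv p, of_uv q, of_uv r}"
  shows "(fst q - fst p) * (snd r - snd p) = (fst r - fst p) * (snd q - snd p)"
proof -
  obtain d where d: "\<And>x y. x \<in> {of_uv p, of_uv q, of_uv r} \<Longrightarrow> y \<in> {of_uv p, of_uv q, of_uv r}
      \<Longrightarrow> \<exists>c. x - y = c *\<^sub>R d"
    using assms unfolding collinear_def by blast
  obtain s t where st: "of_uv q - of_uv p = s *\<^sub>R d" "of_uv r - of_uv p = t *\<^sub>R d"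
    using d[of "of_uv q" "of_uv p"] d[of "of_uv r" "of_uv p"] by auto
  have u: "of_int (fst q - fst p) = s * (fst d + snd d)" "of_int (snd q - snd p) = s * (fst d - snd d)"
    using st(1) by (simp_all add: of_uv_def prod_eq_iff algebra_simps) (simp_all add: field_simps)
  have v: "of_int (fst r - fst p) = t * (fst d + snd d)" "of_int (snd r - snd p) = t * (fst d - snd d)"
    using st(2) by (simp_all add: of_uv_def prod_eq_iff algebra_simps) (simp_all add: field_simps)
  have "real_of_int ((fst q - fst p) * (snd r - snd p)) = of_int ((fst r - fst p) * (snd q - snd p))"
    unfolding of_int_mult u v by simp
  then show ?thesis
    by (simp only: of_int_eq_iff)
qed

section \<open>Integer points on the boundary of a square\<close>

text \<open>The square has its vertical sides through \<open>p\<close> and \<open>q\<close> and its lower side at height \<open>b\<close>.\<close>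

definition on_square :: "('a \<Rightarrow> int) \<Rightarrow> ('a \<Rightarrow> int) \<Rightarrow> 'a \<Rightarrow> 'a \<Rightarrow> int \<Rightarrow> 'a \<Rightarrow> bool" where
  "on_square f g p q b x \<longleftrightarrow>
     f p \<le> f x \<and> f x \<le> f q \<and> b \<le> g x \<and> g x \<le> b + (f q - f p) \<and>
     (f x = f p \<or> f x = f q \<or> g x = b \<or> g x = b + (f q - f p))"

text \<open>Points on both vertical sides turn the side length \<open>2 * r\<close> into the integer
  \<open>f q - f p\<close>. Only the height of the lower side remains to be found: a point on the
  lower or upper side determines it, and otherwise all points lie on the vertical sides and leave it
  some freedom. Keeping \<open>f\<close> and \<open>g\<close> abstract covers both pairs of opposite
  sides.\<close>

lemma on_square_if_opposite_sides:
  fixes f g :: "'a \<Rightarrow> int" and \<alpha> \<beta> r :: real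
  assumes "finite T"
    and sq: "\<And>x. x \<in> T \<Longrightarrow> max \<bar>of_int (f x) - \<alpha>\<bar> \<bar>of_int (g x) - \<beta>\<bar> = r"
    and p: "p \<in> T" "of_int (f p) = \<alpha> - r" and q: "q \<in> T" "of_int (f q) = \<alpha> + r"
  shows "\<exists>c\<in>T. (\<forall>x\<in>T. on_square f g p q (g c) x) \<or>
    (\<forall>x\<in>T. on_square f g p q (g c - (f q - f p)) x)"
proof -
  have side: "\<alpha> - r \<le> of_int (f x) \<and> of_int (f x) \<le> \<alpha> + r \<and> \<beta> - r \<le> of_int (g x) \<and> of_int (g x) \<le> \<beta> + r
      \<and> (of_int (f x) = \<alpha> - r \<or> of_int (f x) = \<alpha> + r \<or> of_int (g x) = \<beta> - r \<or> of_int (g x) = \<beta> + r)"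
    if "x \<in> T" for x
    using sq[OF that] by (auto simp: max_def abs_if split: if_splits)
  have real_iff: "on_square f g p q b x \<longleftrightarrow>
      \<alpha> - r \<le> of_int (f x) \<and> of_int (f x) \<le> \<alpha> + r \<and> of_int b \<le> real_of_int (g x) \<and> of_int (g x) \<le> of_int b + 2 * r
      \<and> (of_int (f x) = \<alpha> - r \<or> of_int (f x) = \<alpha> + r \<or> real_of_int (g x) = of_int b \<or> of_int (g x) = of_int b + 2 * r)"
    for b x
    unfolding on_square_def of_int_le_iff[where 'a = real, symmetric]
      of_int_eq_iff[where 'a = real, symmetric] of_int_add of_int_diff p(2) q(2)
    by simp
  consider (bottom) c where "c \<in> T" "of_int (g c) = \<beta> - r" | (top) c where "c \<in> T" "of_int (g c) = \<beta> + r"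
    | (neither) "\<And>x. x \<in> T \<Longrightarrow> of_int (g x) \<noteq> \<beta> - r \<and> of_int (g x) \<noteq> \<beta> + r"
    by blast
  then show ?thesis
  proof cases
    case bottom
    then have "\<forall>x\<in>T. on_square f g p q (g c) x"
      using side by (force simp: real_iff)
    with bottom show ?thesis by blast
  next
    case top
    \<comment> \<open>The lower side runs one side length below the upper side, which contains
      \<open>c\<close>.\<close>
    have "of_int (g c - (f q - f p)) = \<beta> - r"
      using top(2) p(2) q(2) by simp
    then have "\<forall>x\<in>T. on_square f g p q (g c - (f q - f p)) x"
      using side unfolding real_iff by force
    with top show ?thesis by blast
  next
    case neither
    \<comment> \<open>The square may slide along its two vertical sides until its bottom meets a lowest point.\<close>
    have "Min (g ` T) \<in> g ` T"
      using assms(1) p(1) by (intro Min_in) auto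
    then obtain c where c: "c \<in> T" "g c = Min (g ` T)"
      by auto
    then have "g c \<le> g x" if "x \<in> T" for x
      using assms(1) that by simp
    then have "\<forall>x\<in>T. on_square f g p q (g c) x"
      unfolding real_iff using side neither c(1) by (smt (verit) of_int_le_iff)
    with c show ?thesis by blast
  qed
qed

text \<open>Three members of the set stand in for the real centre and radius, so a finite set leaves
  finitely many squares to test. The two alternatives put \<open>c\<close> on the lower or the upper
  side.\<close>

definition square_witness :: "('a \<Rightarrow> int) \<Rightarrow> ('a \<Rightarrow> int) \<Rightarrow> 'a set \<Rightarrow> bool" where
  "square_witness f g T \<longleftrightarrow>
     (\<exists>p\<in>T. \<exists>q\<in>T. \<exists>c\<in>T. (\<forall>x\<in>T. on_square f g p q (g c) x) \<or>
        (\<forall>x\<in>T. on_square f g p q (g c - (f q - f p)) x))"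

text \<open>A set that meets no two opposite sides lies on at most one vertical and one horizontal
  side. The third alternative keeps just the two lines through these sides and forgets the
  square.\<close>

lemma concyclic_cases:
  assumes "finite T" "T \<noteq> {}" "of_uv ` T \<subseteq> l1_circle z r"
  shows "square_witness fst snd T \<or> square_witness snd fst T \<or>
    (\<exists>p\<in>T. \<exists>c\<in>T. \<forall>x\<in>T. fst x = fst p \<or> snd x = snd c)"
proof -
  obtain a b where z: "z = (a, b)"
    by (cases z)
  define \<alpha> \<beta> where "\<alpha> = a + b" and "\<beta> = a - b"
  have sq: "max \<bar>of_int (fst x) - \<alpha>\<bar> \<bar>of_int (snd x) - \<beta>\<bar> = r" if "x \<in> T" for x
    using assms(3) that unfolding \<alpha>_def \<beta>_def z by (intro of_uv_in_l1_circle) auto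
  then have sq': "max \<bar>of_int (snd x) - \<beta>\<bar> \<bar>of_int (fst x) - \<alpha>\<bar> = r" if "x \<in> T" for x
    using that by (simp add: max.commute)
  have side: "of_int (fst x) = \<alpha> - r \<or> of_int (fst x) = \<alpha> + r \<or> of_int (snd x) = \<beta> - r \<or> of_int (snd x) = \<beta> + r"
    if "x \<in> T" for x
    using sq[OF that] by (auto simp: max_def abs_if split: if_splits)
  \<comment> \<open>At most one of the two values is attained on \<open>T\<close>. If it is
    \<open>\<gamma> - r\<close>, that is the choice of \<open>\<mu>\<close>; otherwise
    \<open>\<gamma> + r\<close> serves.\<close>
  have one_side: "\<exists>\<mu>::real. \<forall>x\<in>T. h x = \<gamma> - r \<or> h x = \<gamma> + r \<longrightarrow> h x = \<mu>"
    if "\<not> (\<exists>p\<in>T. \<exists>q\<in>T. h p = \<gamma> - r \<and> h q = \<gamma> + r)" for h and \<gamma> :: real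
    using that by (cases "\<exists>p\<in>T. h p = \<gamma> - r") blast+
  consider p q where "p \<in> T" "of_int (fst p) = \<alpha> - r" "q \<in> T" "of_int (fst q) = \<alpha> + r"
    | p q where "p \<in> T" "of_int (snd p) = \<beta> - r" "q \<in> T" "of_int (snd q) = \<beta> + r"
    | (corner) "\<not> (\<exists>p\<in>T. \<exists>q\<in>T. of_int (fst p) = \<alpha> - r \<and> of_int (fst q) = \<alpha> + r)"
        "\<not> (\<exists>p\<in>T. \<exists>q\<in>T. of_int (snd p) = \<beta> - r \<and> of_int (snd q) = \<beta> + r)"
    by blast
  then show ?thesis
  proof cases
    case 1
    then show ?thesis
      using on_square_if_opposite_sides[of T fst \<alpha> snd \<beta> r p q, OF assms(1) sq]
      unfolding square_witness_def by blast
  next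
    case 2
    then show ?thesis
      using on_square_if_opposite_sides[of T snd \<beta> fst \<alpha> r p q, OF assms(1) sq']
      unfolding square_witness_def by blast
  next
    case corner
    from one_side[OF corner(1)] one_side[OF corner(2)]
    obtain \<mu> \<nu> :: real where cover: "\<And>x. x \<in> T \<Longrightarrow> of_int (fst x) = \<mu> \<or> of_int (snd x) = \<nu>"
      using side by blast
    \<comment> \<open>The real line is replaced by one through a member of \<open>T\<close>. If the
      line misses \<open>T\<close>, the implication is vacuous and any member will do.\<close>
    have common: "\<exists>p\<in>T. \<forall>x\<in>T. of_int (h x) = \<mu> \<longrightarrow> h x = h p" for h :: "int \<times> int \<Rightarrow> int" and \<mu> :: real
      using assms(2) by (cases "\<exists>p\<in>T. of_int (h p) = \<mu>") auto
    show ?thesis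
      using common[of fst \<mu>] common[of snd \<nu>] cover by meson
  qed
qed

section \<open>Checking configurations given as lists\<close>

text \<open>The bound 3 reflects the ban on four concyclic points. Counting the listed points on one
  curve avoids enumerating four-element subsets.\<close>

definition few :: "'a list \<Rightarrow> ('a \<Rightarrow> bool) \<Rightarrow> bool" where
  "few ps P \<longleftrightarrow> length (filter P ps) \<le> 3"

lemma not_few:
  assumes "T \<subseteq> set ps" "card T = 4" "\<And>x. x \<in> T \<Longrightarrow> P x"
  shows "\<not> few ps P"
proof -
  have "T \<subseteq> set (filter P ps)"
    using assms by auto
  then have "card T \<le> length (filter P ps)"
    by (meson List.finite_set card_length card_mono le_trans)
  then show ?thesis
    using assms(2) by (simp add: few_def)
qed

text \<open>Degenerate triples are harmless: with \<open>{f, g} = {fst, snd}\<close>, a single point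
  can satisfy the test if \<open>f p = f q\<close>, and none if \<open>f q < f p\<close>.\<close>

definition square_free :: "((int \<times> int) \<Rightarrow> int) \<Rightarrow> ((int \<times> int) \<Rightarrow> int) \<Rightarrow> (int \<times> int) list \<Rightarrow> bool" where
  "square_free f g ps \<longleftrightarrow>
     list_all (\<lambda>p. list_all (\<lambda>q. list_all (\<lambda>c. few ps (on_square f g p q (g c)) \<and>
        few ps (on_square f g p q (g c - (f q - f p)))) ps) ps) ps"

definition corner_free :: "(int \<times> int) list \<Rightarrow> bool" where
  "corner_free ps \<longleftrightarrow>
     list_all (\<lambda>p. list_all (\<lambda>c. few ps (\<lambda>x. fst x = fst p \<or> snd x = snd c)) ps) ps"

definition collinear_free :: "(int \<times> int) list \<Rightarrow> bool" where
  "collinear_free ps \<longleftrightarrow>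
     list_all (\<lambda>p. list_all (\<lambda>q. p = q \<or> list_all (\<lambda>r. p = r \<or> q = r \<or>
        (fst q - fst p) * (snd r - snd p) \<noteq> (fst r - fst p) * (snd q - snd p)) ps) ps) ps"

text \<open>With labels 1 to 4 in the order \<open>a\<close>, \<open>b\<close>, \<open>c\<close>,
  \<open>d\<close>, the three gaps of size one agree and so do the two gaps of size two. Rejecting
  every quadruple with these equalities is at least as strict as rejecting line-like ones.\<close>

definition line_like_free :: "(int \<times> int) list \<Rightarrow> bool" where
  "line_like_free ps \<longleftrightarrow>
     list_all (\<lambda>a. list_all (\<lambda>b. a = b \<or> list_all (\<lambda>c. a = c \<or> b = c \<or> chebyshev a b \<noteq> chebyshev b c \<or>
        list_all (\<lambda>d. a = d \<or> b = d \<or> c = d \<or> chebyshev a b \<noteq> chebyshev c d \<or>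
          chebyshev a c \<noteq> chebyshev b d) ps) ps) ps) ps"

lemma square_free_imp_no_witness:
  assumes "square_free f g ps" "T \<subseteq> set ps" "card T = 4"
  shows "\<not> square_witness f g T"
proof
  assume "square_witness f g T"
  then obtain p q c P where "p \<in> T" "q \<in> T" "c \<in> T" "\<forall>x\<in>T. P x"
    and P: "P = on_square f g p q (g c) \<or> P = on_square f g p q (g c - (f q - f p))"
    unfolding square_witness_def by blast
  then have "few ps P"
    using assms(1,2) unfolding square_free_def list_all_iff by blast
  then show False
    using not_few[OF assms(2,3)] \<open>\<forall>x\<in>T. P x\<close> by blast
qed

text \<open>The points are listed by their labels, through a right inverse of the labelling; equal
  label differences then give equal distances.\<close>

lemma line_like_of_uvD:
  assumes "l1_line_like 4 (of_uv ` T)"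
  obtains a b c d where "{a, b, c, d} \<subseteq> T" "distinct [a, b, c, d]"
    "chebyshev a b = chebyshev b c" "chebyshev a b = chebyshev c d" "chebyshev a c = chebyshev b d"
proof -
  obtain \<phi> where \<phi>: "bij_betw \<phi> (of_uv ` T) {1..4::nat}"
    and iso: "\<And>a b c d. \<lbrakk>a \<in> T; b \<in> T; c \<in> T; d \<in> T\<rbrakk> \<Longrightarrow>
      l1_norm (of_uv a - of_uv b) = l1_norm (of_uv c - of_uv d) \<longleftrightarrow>
      \<bar>int (\<phi> (of_uv a)) - int (\<phi> (of_uv b))\<bar> = \<bar>int (\<phi> (of_uv c)) - int (\<phi> (of_uv d))\<bar>"
    using assms unfolding l1_line_like_def by blast
  have "\<exists>a\<in>T. \<phi> (of_uv a) = i" if "i \<in> {1..4}" for i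
    using bij_betw_imp_surj_on[OF \<phi>] that by (metis imageE)
  then obtain g where g: "\<And>i. i \<in> {1..4} \<Longrightarrow> g i \<in> T \<and> \<phi> (of_uv (g i)) = i"
    by metis
  have cheb: "chebyshev (g i) (g j) = chebyshev (g k) (g l)"
    if "{i, j, k, l} \<subseteq> {1..4}" "\<bar>int i - int j\<bar> = \<bar>int k - int l\<bar>" for i j k l
    using iso[of "g i" "g j" "g k" "g l"] g[of i] g[of j] g[of k] g[of l] that
    by (simp add: l1_norm_of_uv_diff)
  show thesis
  proof
    show "{g 1, g 2, g 3, g 4} \<subseteq> T"
      using g by simp
    have "g i \<noteq> g j" if "i \<in> {1..4}" "j \<in> {1..4}" "i \<noteq> j" for i j
      using g that by metis
    then show "distinct [g 1, g 2, g 3, g 4]"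
      by simp
  qed (rule cheb; simp)+
qed

lemma strong_general_position_if_free:
  assumes "collinear_free ps" "square_free fst snd ps" "square_free snd fst ps"
    "corner_free ps" "line_like_free ps"
  shows "l1_strong_general_position (of_uv ` set ps)"
proof -
  \<comment> \<open>By injectivity, each subset of the configuration comes from a set of integer
    pairs of the same size, so the three conditions can be tested there.\<close>
  have preimage: "\<exists>T. T \<subseteq> set ps \<and> U = of_uv ` T \<and> card T = card U" if "U \<subseteq> of_uv ` set ps" for U
    using that inj_of_uv by (metis card_image inj_on_subset subset_UNIV subset_imageE)
  have "\<not> collinear (of_uv ` T)" if T: "T \<subseteq> set ps" "card T = 3" for T
  proof
    obtain p q r where pqr: "T = {p, q, r}" "p \<noteq> q" "p \<noteq> r" "q \<noteq> r"
      using T(2) by (auto simp: card_3_iff)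
    assume "collinear (of_uv ` T)"
    then have "(fst q - fst p) * (snd r - snd p) = (fst r - fst p) * (snd q - snd p)"
      by (intro collinear_of_uvD) (simp add: pqr)
    then show False
      using assms(1) T(1) pqr unfolding collinear_free_def list_all_iff by blast
  qed
  moreover have "\<not> of_uv ` T \<subseteq> l1_circle z r" if T: "T \<subseteq> set ps" "card T = 4" for T z r
  proof
    assume circle: "of_uv ` T \<subseteq> l1_circle z r"
    have "finite T" "T \<noteq> {}"
      using T by (auto intro: finite_subset)
    \<comment> \<open>The two \<open>square_free\<close> checks exclude the first two alternatives,
      which leaves a cover by a vertical and a horizontal line.\<close>
    from concyclic_cases[OF this circle] obtain p c where "p \<in> T" "c \<in> T"
      "\<And>x. x \<in> T \<Longrightarrow> fst x = fst p \<or> snd x = snd c"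
      using square_free_imp_no_witness[OF _ T] assms(2,3) by blast
    then show False
      using assms(4) T not_few[OF T, of "\<lambda>x. fst x = fst p \<or> snd x = snd c"]
      unfolding corner_free_def list_all_iff by blast
  qed
  moreover have "\<not> l1_line_like 4 (of_uv ` T)" if T: "T \<subseteq> set ps" for T
  proof
    assume "l1_line_like 4 (of_uv ` T)"
    then obtain a b c d where "{a, b, c, d} \<subseteq> T" "distinct [a, b, c, d]"
      "chebyshev a b = chebyshev b c" "chebyshev a b = chebyshev c d" "chebyshev a c = chebyshev b d"
      by (rule line_like_of_uvD)
    moreover from this have "a \<in> set ps" "b \<in> set ps" "c \<in> set ps" "d \<in> set ps"
      using T by auto
    from this have "a = b \<or> a = c \<or> b = c \<or> a = d \<or> b = d \<or> c = d \<or> chebyshev a b \<noteq> chebyshev b c \<or>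
        chebyshev a b \<noteq> chebyshev c d \<or> chebyshev a c \<noteq> chebyshev b d"
      using assms(5) unfolding line_like_free_def list_all_iff by blast
    ultimately show False
      by simp
  qed
  ultimately show ?thesis
    unfolding l1_strong_general_position_def using preimage by metis
qed

section \<open>Distances and their multiplicities\<close>

fun pair_dists :: "(int \<times> int) list \<Rightarrow> int list" where
  "pair_dists [] = []"
| "pair_dists (p # ps) = map (chebyshev p) ps @ pair_dists ps"

lemma chebyshev_commute: "chebyshev p q = chebyshev q p"
  by (simp add: chebyshev_def abs_minus_commute)

lemma set_pair_dists:
  assumes "distinct ps"
  shows "set (pair_dists ps) = {chebyshev a b | a b. a \<in> set ps \<and> b \<in> set ps \<and> a \<noteq> b}"
  using assms
proof (induction ps)
  case (Cons p ps)
  then have "set (pair_dists (p # ps)) =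
      chebyshev p ` set ps \<union> {chebyshev a b | a b. a \<in> set ps \<and> b \<in> set ps \<and> a \<noteq> b}"
    by simp
  also have "\<dots> = {chebyshev a b | a b. a \<in> set (p # ps) \<and> b \<in> set (p # ps) \<and> a \<noteq> b}"
  proof (intro equalityI subsetI)
    fix k
    assume "k \<in> {chebyshev a b | a b. a \<in> set (p # ps) \<and> b \<in> set (p # ps) \<and> a \<noteq> b}"
    then obtain a b where "k = chebyshev a b" "a \<in> set (p # ps)" "b \<in> set (p # ps)" "a \<noteq> b"
      by blast
    \<comment> \<open>The head \<open>p\<close> may be either member of the pair, whereas the list
      measures distances from \<open>p\<close> first.\<close>
    moreover from this have "k = chebyshev b a"
      by (simp add: chebyshev_commute)
    ultimately show "k \<in> chebyshev p ` set ps \<union> {chebyshev a b | a b. a \<in> set ps \<and> b \<in> set ps \<and> a \<noteq> b}"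
      unfolding list.set by blast
  next
    fix k
    assume "k \<in> chebyshev p ` set ps \<union> {chebyshev a b | a b. a \<in> set ps \<and> b \<in> set ps \<and> a \<noteq> b}"
    moreover have "p \<notin> set ps"
      using Cons.prems by simp
    ultimately show "k \<in> {chebyshev a b | a b. a \<in> set (p # ps) \<and> b \<in> set (p # ps) \<and> a \<noteq> b}"
      unfolding list.set by blast
  qed
  finally show ?case .
qed simp

lemma l1_distances_of_uv:
  assumes "distinct ps"
  shows "l1_distances (of_uv ` set ps) = of_int ` set (pair_dists ps)"
proof -
  have "l1_distances (of_uv ` set ps) =
      {of_int (chebyshev a b) | a b. a \<in> set ps \<and> b \<in> set ps \<and> a \<noteq> b}"
    unfolding l1_distances_def
    using l1_norm_of_uv_diff inj_eq[OF inj_of_uv] by (smt (verit) Collect_cong imageE imageI)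
  also have "\<dots> = of_int ` {chebyshev a b | a b. a \<in> set ps \<and> b \<in> set ps \<and> a \<noteq> b}"
  proof (intro equalityI subsetI)
    fix y :: real
    assume "y \<in> {of_int (chebyshev a b) | a b. a \<in> set ps \<and> b \<in> set ps \<and> a \<noteq> b}"
    then obtain a b where "y = of_int (chebyshev a b)" "a \<in> set ps \<and> b \<in> set ps \<and> a \<noteq> b"
      by blast
    then show "y \<in> of_int ` {chebyshev a b | a b. a \<in> set ps \<and> b \<in> set ps \<and> a \<noteq> b}"
      by (intro image_eqI[of _ _ "chebyshev a b"]) blast+
  qed blast
  finally show ?thesis
    unfolding set_pair_dists[OF assms] .
qed

text \<open>Each unordered pair contributes one entry to \<open>pair_dists\<close>. In the
  induction, the pairs containing the head correspond to the later points at distance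
  \<open>k\<close> from it; distinctness makes them disjoint from the pairs within the tail.\<close>

lemma l1_multiplicity_of_uv:
  assumes "distinct ps"
  shows "l1_multiplicity (of_uv ` set ps) (of_int k) = count_list (pair_dists ps) k"
proof -
  define pairs where "pairs A = {{a, b} | a b. a \<in> A \<and> b \<in> A \<and> a \<noteq> b \<and> chebyshev a b = k}" for A
  have "{{x, y} | x y. x \<in> of_uv ` A \<and> y \<in> of_uv ` A \<and> x \<noteq> y \<and> l1_norm (x - y) = of_int k} =
      image of_uv ` pairs A" for A
  proof (intro equalityI subsetI)
    fix e
    assume "e \<in> {{x, y} | x y. x \<in> of_uv ` A \<and> y \<in> of_uv ` A \<and> x \<noteq> y \<and> l1_norm (x - y) = of_int k}"
    then obtain a b where "e = {of_uv a, of_uv b}" "a \<in> A" "b \<in> A" "a \<noteq> b" "chebyshev a b = k"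
      by (smt (verit) imageE l1_norm_of_uv_diff mem_Collect_eq of_int_eq_iff)
    then show "e \<in> image of_uv ` pairs A"
      unfolding pairs_def by (intro image_eqI[of _ _ "{a, b}"]) (simp, blast)
  next
    fix e
    assume "e \<in> image of_uv ` pairs A"
    then obtain a b where "e = {of_uv a, of_uv b}" "a \<in> A" "b \<in> A" "a \<noteq> b" "chebyshev a b = k"
      unfolding pairs_def by auto
    then show "e \<in> {{x, y} | x y. x \<in> of_uv ` A \<and> y \<in> of_uv ` A \<and> x \<noteq> y \<and> l1_norm (x - y) = of_int k}"
      using inj_eq[OF inj_of_uv] l1_norm_of_uv_diff by blast
  qed
  then have "l1_multiplicity (of_uv ` set ps) (of_int k) = card (image of_uv ` pairs (set ps))"
    by (simp add: l1_multiplicity_def)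
  also have "\<dots> = card (pairs (set ps))"
    \<comment> \<open>An injective map also acts injectively on sets, so distinct pairs stay
      distinct.\<close>
    using inj_of_uv by (intro card_image) (meson inj_image_eq_iff inj_onI)
  also have "\<dots> = count_list (pair_dists ps) k"
    using assms
  proof (induction ps)
    case Nil
    then show ?case by (simp add: pairs_def)
  next
    case (Cons p ps)
    let ?new = "(\<lambda>q. {p, q}) ` set (filter (\<lambda>q. chebyshev p q = k) ps)"
    have split: "pairs (set (p # ps)) = ?new \<union> pairs (set ps)"
    proof (intro equalityI subsetI)
      fix e
      assume "e \<in> pairs (set (p # ps))"
      then obtain a b where "e = {a, b}" "a \<in> set (p # ps)" "b \<in> set (p # ps)" "a \<noteq> b" "chebyshev a b = k"
        unfolding pairs_def by blast
      moreover from this have "e = {b, a}" "chebyshev b a = k"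
        by (simp_all add: insert_commute chebyshev_commute)
      ultimately show "e \<in> ?new \<union> pairs (set ps)"
        unfolding pairs_def list.set set_filter by blast
    next
      fix e
      assume "e \<in> ?new \<union> pairs (set ps)"
      moreover have "p \<notin> set ps"
        using Cons.prems by simp
      ultimately show "e \<in> pairs (set (p # ps))"
        unfolding pairs_def list.set set_filter by blast
    qed
    have "finite (pairs (set ps))"
      by (rule finite_subset[of _ "Pow (set ps)"]) (auto simp: pairs_def)
    moreover have "?new \<inter> pairs (set ps) = {}"
      using Cons.prems unfolding pairs_def by (auto simp: doubleton_eq_iff)
    ultimately have "card (pairs (set (p # ps))) = card ?new + card (pairs (set ps))"
      unfolding split by (intro card_Un_disjoint) auto
    moreover have "card ?new = card (set (filter (\<lambda>q. chebyshev p q = k) ps))"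
      by (intro card_image inj_onI) (auto simp: doubleton_eq_iff)
    moreover have "\<dots> = length (filter (\<lambda>q. chebyshev p q = k) ps)"
      using Cons.prems by (simp add: distinct_card del: set_filter)
    moreover have "\<dots> = count_list (map (chebyshev p) ps) k"
      by (induction ps) auto
    ultimately show ?case
      using Cons by simp
  qed
  finally show ?thesis .
qed

text \<open>Using \<open>Suc\<close> for the number of distances avoids truncated subtraction and
  rules out the empty list. The exclusive end of \<open>[1..<length ps]\<close> makes the
  multiplicities run up to \<open>length ps - 1\<close>.\<close>

definition crescent_check :: "(int \<times> int) list \<Rightarrow> bool" where
  "crescent_check ps \<longleftrightarrow>
     distinct ps \<and> collinear_free ps \<and> square_free fst snd ps \<and> square_free snd fst ps \<and>
     corner_free ps \<and> line_like_free ps \<and>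
     (let ds = pair_dists ps; ks = remdups ds in
        Suc (length ks) = length ps \<and>
        list_all (\<lambda>i. list_ex (\<lambda>k. count_list ds k = i) ks) [1..<length ps])"

lemma strong_crescent_if_check:
  assumes "crescent_check ps"
  shows "l1_strong_crescent (length ps) (of_uv ` set ps)"
proof -
  note check = assms[unfolded crescent_check_def Let_def]
  have "distinct ps"
    using check by blast
  then have dists: "l1_distances (of_uv ` set ps) = of_int ` set (pair_dists ps)"
    by (rule l1_distances_of_uv)
  have "card (of_uv ` set ps) = length ps"
    using \<open>distinct ps\<close> inj_of_uv by (metis card_image distinct_card inj_on_subset subset_UNIV)
  moreover have "l1_strong_general_position (of_uv ` set ps)"
    using check by (intro strong_general_position_if_free) auto
  moreover have "card (l1_distances (of_uv ` set ps)) = length ps - 1"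
  proof -
    have "card (l1_distances (of_uv ` set ps)) = card (set (pair_dists ps))"
      unfolding dists by (intro card_image) (simp add: inj_on_def)
    also have "\<dots> = length (remdups (pair_dists ps))"
      by (simp add: length_remdups_card_conv)
    finally show ?thesis
      using check by auto
  qed
  moreover have "\<exists>\<delta>\<in>l1_distances (of_uv ` set ps). l1_multiplicity (of_uv ` set ps) \<delta> = i"
    if "i \<in> {1..length ps - 1}" for i
  proof -
    have "i \<in> set [1..<length ps]"
      using that by auto
    then obtain k where "k \<in> set (pair_dists ps)" "count_list (pair_dists ps) k = i"
      using check unfolding list_all_iff list_ex_iff set_remdups by blast
    then show ?thesis
      unfolding dists by (auto simp: l1_multiplicity_of_uv[OF \<open>distinct ps\<close>])
  qed
  ultimately show ?thesis
    unfolding l1_strong_crescent_def by blast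
qed

section \<open>Explicit configurations of sizes one to eight\<close>

definition crescents :: "(int \<times> int) list list" where
  "crescents =
     [[(0, 0)],
      [(0, 2), (3, 0)],
      [(0, 1), (4, 3), (0, 4)],
      [(3, 3), (0, 4), (3, 2), (4, 3)],
      [(0, 6), (3, 1), (6, 5), (4, 5), (5, 3)],
      [(0, 0), (0, 6), (5, 5), (3, 2), (6, 0), (1, 3)],
      [(1, 5), (3, 6), (0, 8), (6, 1), (5, 4), (2, 3), (0, 1)],
      [(6, 9), (5, 6), (7, 4), (8, 10), (3, 7), (4, 5), (2, 8), (1, 4)]]"

text \<open>All conditions are quantifiers over list entries and integer comparisons, so rewriting
  with the code equations decides them.\<close>

lemma crescent_check_crescents: "list_all crescent_check crescents"
  by code_simp

lemma map_length_crescents: "map length crescents = [1..<9]"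
  by code_simp

theorem corollary1p10:
  fixes n :: nat
  assumes "1 \<le> n" and "n \<le> 8"
  shows "\<exists>S. l1_strong_crescent n S"
proof -
  \<comment> \<open>The lengths run through 1 to 8, as the end 9 is exclusive, so some listed
    configuration has size \<open>n\<close>.\<close>
  have "n \<in> set (map length crescents)"
    unfolding map_length_crescents using assms by simp
  then obtain ps where "ps \<in> set crescents" "n = length ps"
    by auto
  then have "crescent_check ps"
    using crescent_check_crescents unfolding list_all_iff by blast
  then have "l1_strong_crescent n (of_uv ` set ps)"
    unfolding \<open>n = length ps\<close> by (rule strong_crescent_if_check)
  then show ?thesis
    by blast
qed

end
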